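(* Let $I=[a,b]$, $J=[c,d]$, $t\in(a,b)$, $s\in(c,d)$, and let $f\in\mathcal{A}_t(I)$ and $g\in\mathcal{A}_s(J)$. Then $f$ and $g$ are topologically conjugate if and only if one of the following two cases holds: (C1) $f(t-0)<f(t)<f(t+0)$ and $g(s-0)<g(s)<g(s+0)$; (C2) $f(t)=f(t-0)$ and $g(s)=g(s-0)$, or $f(t)=f(t-0)$ and $g(s)=g(s+0)$, or $f(t)=f(t+0)$ and $g(s)=g(s-0)$, or $f(t)=f(t+0)$ and $g(s)=g(s+0)$.
   Context: For a closed interval $I=[a,b]$ and $t\in(a,b)$, $\mathcal{A}_t(I)$ denotes the family of strictly increasing functions $f:I\to I$ whose only discontinuity is a jump discontinuity at $t$, and such that (i) $f(t-0)\le f(t)\le f(t+0)$, and (ii) $f$ has exactly two fixed points, namely $a$ and $b$, and both are attractive. Here $f(t-0)$ and $f(t+0)$ are the left and right limits of $f$ at $t$. The family $\mathcal{A}_s(J)$ is defined in the same way for $J=[c,d]$ and $s\in(c,d)$. Self-maps $f:I\to I$ and $g:J\to J$ are topologically conjugate if there is a homeomorphism $\varphi:I\to J$ (increasing or decreasing) with $\varphi\circ f=g\circ\varphi$ on $I$.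
   Formalization: Added hypothesis: f(t-0)=t or f(t+0)=t holds if and only if g(s-0)=s or g(s+0)=s holds. Without it the claim fails, e.g. on [-1,1] with t=s=0 when f(0-0)=0 but g(0-0)<0; it holds automatically if f(t-0)<t<f(t+0) and g(s-0)<s<g(s+0). *)

theory Defs
  imports "HOL-Analysis.Analysis"
begin

text \<open>
  A self-map of the interval \<open>{a..b}\<close> is a total function on the reals that maps \<open>{a..b}\<close> into
  itself; its values outside \<open>{a..b}\<close> are irrelevant. The one-sided limits below are only taken at
  interior points of the interval, so they do not depend on those values either.
\<close>

definition left_lim :: "(real \<Rightarrow> real) \<Rightarrow> real \<Rightarrow> real"
  where "left_lim f t = Lim (at_left t) f"

definition right_lim :: "(real \<Rightarrow> real) \<Rightarrow> real \<Rightarrow> real"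
  where "right_lim f t = Lim (at_right t) f"

definition jump_discontinuity :: "(real \<Rightarrow> real) \<Rightarrow> real \<Rightarrow> bool"
  where "jump_discontinuity f t \<longleftrightarrow>
    (\<exists>l r. (f \<longlongrightarrow> l) (at_left t) \<and> (f \<longlongrightarrow> r) (at_right t) \<and> l \<noteq> r)"

text \<open>Neighbourhoods are relative to the space \<open>S\<close>: for \<open>S = {a..b}\<close> and \<open>p = a\<close> they are one-sided.\<close>

definition attractive_fixed_point :: "('a::topological_space \<Rightarrow> 'a) \<Rightarrow> 'a set \<Rightarrow> 'a \<Rightarrow> bool"
  where "attractive_fixed_point f S p \<longleftrightarrow> p \<in> S \<and> f p = p \<and>
    (\<exists>U. openin (top_of_set S) U \<and> p \<in> U \<and> (\<forall>x\<in>U. (\<lambda>n. (f ^^ n) x) \<longlonglongrightarrow> p))"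

text \<open>The family \<open>\<A>\<^sub>t(I)\<close> for \<open>I = {a..b}\<close>.\<close>

definition jump_family :: "real \<Rightarrow> real \<Rightarrow> real \<Rightarrow> (real \<Rightarrow> real) set"
  where "jump_family a b t = {f.
    f ` {a..b} \<subseteq> {a..b} \<and>
    strict_mono_on {a..b} f \<and>
    (\<forall>x\<in>{a..b} - {t}. continuous (at x within {a..b}) f) \<and>
    jump_discontinuity f t \<and>
    left_lim f t \<le> f t \<and> f t \<le> right_lim f t \<and>
    {x\<in>{a..b}. f x = x} = {a, b} \<and>
    attractive_fixed_point f {a..b} a \<and>
    attractive_fixed_point f {a..b} b}"

definition topologically_conjugate ::
    "'a::topological_space set \<Rightarrow> ('a \<Rightarrow> 'a) \<Rightarrow> 'b::topological_space set \<Rightarrow> ('b \<Rightarrow> 'b) \<Rightarrow> bool"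
  where "topologically_conjugate S f T g \<longleftrightarrow>
    (\<exists>\<phi> \<psi>. homeomorphism S T \<phi> \<psi> \<and> (\<forall>x\<in>S. \<phi> (f x) = g (\<phi> x)))"

text \<open>
  \<open>limit_fixes f t\<close> says that \<open>t\<close> is fixed in the one-sided sense, \<open>f(t-0) = t\<close> or \<open>f(t+0) = t\<close>. The
  conditions defining \<open>\<A>\<^sub>t(I)\<close> force \<open>f(t) \<noteq> t\<close>, but they do not exclude this borderline case. It is
  invariant under conjugacy and invisible to the order relations between \<open>f(t-0)\<close>, \<open>f(t)\<close> and
  \<open>f(t+0)\<close>: on \<open>[-1, 1]\<close> with \<open>t = 0\<close>, the maps that equal \<open>(x + 1) / 2\<close> for \<open>x \<ge> 0\<close> and, for
  \<open>x < 0\<close>, equal \<open>- sqrt (- x)\<close> and \<open>(x - 1) / 2\<close> respectively both belong to the family and agree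
  with their right limit at \<open>0\<close>, but they are not conjugate. A classification by those order
  relations therefore needs the two maps to agree in this respect, which they do in particular
  when neither \<open>f\<close> nor \<open>g\<close> is borderline, that is, \<open>f(t-0) < t < f(t+0)\<close> and
  \<open>g(s-0) < s < g(s+0)\<close>.
\<close>

definition limit_fixes :: "(real \<Rightarrow> real) \<Rightarrow> real \<Rightarrow> bool"
  where "limit_fixes f t \<longleftrightarrow> left_lim f t = t \<or> right_lim f t = t"

end

theory Submission
  imports Defs
begin

text \<open>
  Write \<open>l \<le> f t \<le> r\<close> for the value at the jump and the one-sided limits. The value \<open>f t\<close> is
  isolated in the image of \<open>f\<close> exactly when \<open>l < f t < r\<close>, and every other value is a limit point of
  the image; hence a conjugacy preserves this strictness. Conversely, after a reflection one may assume
  \<open>f t < t\<close>, and similarly for \<open>g\<close>. On \<open>[a, t]\<close> the continuous modification of \<open>f\<close> pushes points down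
  towards \<open>a\<close>, and \<open>(l, t]\<close> is a fundamental domain that may be mapped to the one of \<open>g\<close> by any
  increasing bijection sending \<open>f t\<close> to \<open>g s\<close>; spreading it along the orbits gives the conjugacy on
  \<open>[a, t]\<close>. The same works on \<open>[t, b]\<close> when \<open>t < r\<close>; when \<open>r = t\<close> the modification fixes both end
  points. Increasing bijections of compact intervals are homeomorphisms, so only the order of the
  points has to be controlled.
\<close>

section \<open>Increasing bijections of intervals\<close>

text \<open>Neither continuity nor an inverse is recorded: a strictly increasing map of one compact
  interval onto another has both. In the construction, reversal of order enters only later, through
  \<open>reflect\<close>.\<close>

definition order_conjugacy ::
    "real \<Rightarrow> real \<Rightarrow> (real \<Rightarrow> real) \<Rightarrow> real \<Rightarrow> real \<Rightarrow> (real \<Rightarrow> real) \<Rightarrow> (real \<Rightarrow> real) \<Rightarrow> bool"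
  where "order_conjugacy a b F c d G \<phi> \<longleftrightarrow>
    strict_mono_on {a..b} \<phi> \<and> \<phi> ` {a..b} = {c..d} \<and> (\<forall>x\<in>{a..b}. \<phi> (F x) = G (\<phi> x))"

lemma strict_mono_image_endpoints:
  fixes \<phi> :: "real \<Rightarrow> real"
  assumes mono: "strict_mono_on {a..b} \<phi>" and im: "\<phi> ` {a..b} = {c..d}" and "a \<le> b"
  shows "\<phi> a = c" "\<phi> b = d"
proof -
  have le: "\<phi> a \<le> \<phi> x" "\<phi> x \<le> \<phi> b" if "x \<in> {a..b}" for x
    using strict_mono_on_leD[OF mono] that \<open>a \<le> b\<close> by auto
  have ab: "\<phi> a \<in> {c..d}" "\<phi> b \<in> {c..d}"
    using im \<open>a \<le> b\<close> by auto
  then have "c \<in> \<phi> ` {a..b}" "d \<in> \<phi> ` {a..b}"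
    unfolding im by auto
  then show "\<phi> a = c" "\<phi> b = d"
    using le ab by force+
qed

text \<open>A monotone map that misses no value cannot jump. Either \<open>\<phi> x - e / 2\<close>
  is attained, and its preimage bounds a neighbourhood of \<open>x\<close> on the left, or it lies
  below the range and the lower estimate is trivial. The upper estimate is symmetric.\<close>

lemma strict_mono_surj_continuous:
  fixes \<phi> :: "real \<Rightarrow> real"
  assumes mono: "strict_mono_on {a..b} \<phi>" and im: "\<phi> ` {a..b} = {c..d}"
  shows "continuous_on {a..b} \<phi>"
  unfolding continuous_on_iff dist_real_def
proof (intro ballI allI impI)
  fix x e :: real
  assume x: "x \<in> {a..b}" and e: "e > 0"
  note le = strict_mono_on_less_eq[OF mono] and less = strict_mono_on_less[OF mono]
  have range: "c \<le> \<phi> z \<and> \<phi> z \<le> d" if "z \<in> {a..b}" for z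
    using im that by auto
  have "\<exists>d1>0. \<forall>z\<in>{a..b}. x - d1 < z \<longrightarrow> \<phi> x - e < \<phi> z"
  proof (cases "c \<le> \<phi> x - e / 2")
    case True
    then have "\<phi> x - e / 2 \<in> \<phi> ` {a..b}"
      using range[OF x] e im by auto
    then obtain y where y: "y \<in> {a..b}" "\<phi> y = \<phi> x - e / 2" by auto
    then have "y < x" using less[OF y(1) x] e by simp
    moreover have "\<phi> x - e < \<phi> z" if "z \<in> {a..b}" "y < z" for z
      using less[OF y(1) that(1)] that(2) y(2) e by simp
    ultimately show ?thesis by (intro exI[of _ "x - y"]) auto
  next
    case False
    then have "\<phi> x - e < \<phi> z" if "z \<in> {a..b}" for z
      using range[OF that] e by simp
    then show ?thesis by (intro exI[of _ 1]) auto
  qed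
  then obtain d1 where d1: "d1 > 0" "\<And>z. z \<in> {a..b} \<Longrightarrow> x - d1 < z \<Longrightarrow> \<phi> x - e < \<phi> z"
    by blast
  have "\<exists>d2>0. \<forall>z\<in>{a..b}. z < x + d2 \<longrightarrow> \<phi> z < \<phi> x + e"
  proof (cases "\<phi> x + e / 2 \<le> d")
    case True
    then have "\<phi> x + e / 2 \<in> \<phi> ` {a..b}"
      using range[OF x] e im by auto
    then obtain y where y: "y \<in> {a..b}" "\<phi> y = \<phi> x + e / 2" by auto
    then have "x < y" using less[OF x y(1)] e by simp
    moreover have "\<phi> z < \<phi> x + e" if "z \<in> {a..b}" "z < y" for z
      using less[OF that(1) y(1)] that(2) y(2) e by simp
    ultimately show ?thesis by (intro exI[of _ "y - x"]) auto
  next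
    case False
    then have "\<phi> z < \<phi> x + e" if "z \<in> {a..b}" for z
      using range[OF that] e by simp
    then show ?thesis by (intro exI[of _ 1]) auto
  qed
  then obtain d2 where d2: "d2 > 0" "\<And>z. z \<in> {a..b} \<Longrightarrow> z < x + d2 \<Longrightarrow> \<phi> z < \<phi> x + e"
    by blast
  have "\<bar>\<phi> z - \<phi> x\<bar> < e" if "z \<in> {a..b}" "\<bar>z - x\<bar> < min d1 d2" for z
    using d1(2)[OF that(1)] d2(2)[OF that(1)] that(2) by (simp add: abs_less_iff)
  then show "\<exists>d>0. \<forall>x'\<in>{a..b}. \<bar>x' - x\<bar> < d \<longrightarrow> \<bar>\<phi> x' - \<phi> x\<bar> < e"
    using d1(1) d2(1) by (intro exI[of _ "min d1 d2"]) auto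
qed

text \<open>The inverse is again strictly increasing and onto, so the same continuity argument
  serves both directions.\<close>

lemma strict_mono_surj_homeomorphism:
  fixes \<phi> :: "real \<Rightarrow> real"
  assumes mono: "strict_mono_on {a..b} \<phi>" and im: "\<phi> ` {a..b} = {c..d}"
  shows "homeomorphism {a..b} {c..d} \<phi> (inv_into {a..b} \<phi>)"
proof -
  let ?\<psi> = "inv_into {a..b} \<phi>"
  have inj: "inj_on \<phi> {a..b}"
    using mono by (rule strict_mono_on_imp_inj_on)
  have im': "?\<psi> ` {c..d} = {a..b}"
    using inj_on_imp_bij_betw[OF inj] im by (metis bij_betw_def bij_betw_inv_into)
  have right: "\<phi> (?\<psi> y) = y" if "y \<in> {c..d}" for y
    using that im by (simp add: f_inv_into_f)
  have "strict_mono_on {c..d} ?\<psi>"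
  proof (rule strict_mono_onI)
    fix y z assume "y \<in> {c..d}" "z \<in> {c..d}" "y < z"
    then show "?\<psi> y < ?\<psi> z"
      using strict_mono_on_less[OF mono, of "?\<psi> y" "?\<psi> z"] im' right by (metis imageI)
  qed
  then have "continuous_on {c..d} ?\<psi>"
    using im' by (rule strict_mono_surj_continuous)
  moreover have "continuous_on {a..b} \<phi>"
    using assms by (rule strict_mono_surj_continuous)
  ultimately show ?thesis
    using im im' right inj by (intro homeomorphismI) auto
qed

lemma order_conjugacy_topologically_conjugate:
  assumes "order_conjugacy a b F c d G \<phi>"
  shows "topologically_conjugate {a..b} F {c..d} G"
proof -
  have "homeomorphism {a..b} {c..d} \<phi> (inv_into {a..b} \<phi>)"
    using assms strict_mono_surj_homeomorphism by (simp add: order_conjugacy_def)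
  then show ?thesis
    using assms unfolding order_conjugacy_def topologically_conjugate_def by auto
qed

text \<open>The pieces agree at \<open>p\<close> because their images force both to send
  \<open>p\<close> to \<open>q\<close>.\<close>

lemma strict_mono_on_glue:
  fixes \<phi> :: "real \<Rightarrow> real"
  assumes "strict_mono_on {a..p} \<phi>" "\<phi> ` {a..p} = {c..q}"
    and "strict_mono_on {p..b} \<psi>" "\<psi> ` {p..b} = {q..d}"
    and "a \<le> p" "p \<le> b"
  shows "strict_mono_on {a..b} (\<lambda>x. if x \<le> p then \<phi> x else \<psi> x)"
    and "(\<lambda>x. if x \<le> p then \<phi> x else \<psi> x) ` {a..b} = {c..d}"
proof -
  let ?h = "\<lambda>x. if x \<le> p then \<phi> x else \<psi> x"
  have p: "\<phi> p = q" "\<psi> p = q"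
    using strict_mono_image_endpoints assms by blast+
  have qq: "c \<le> q" "q \<le> d"
  proof -
    have "\<phi> a \<in> {c..q}" "\<psi> b \<in> {q..d}" using assms by auto
    then show "c \<le> q" "q \<le> d" by auto
  qed
  show "strict_mono_on {a..b} ?h"
  proof (rule strict_mono_onI)
    fix x y assume xy: "x \<in> {a..b}" "y \<in> {a..b}" "x < y"
    consider "y \<le> p" | "p \<le> x" | "x \<le> p" "p < y" by linarith
    then show "?h x < ?h y"
    proof cases
      case 1 then show ?thesis using xy strict_mono_onD[OF assms(1), of x y] by auto
    next
      case 2 then show ?thesis using xy strict_mono_onD[OF assms(3), of x y] p by auto
    next
      case 3
      then have "\<phi> x \<in> {c..q}" "\<psi> p < \<psi> y"
        using xy assms(2) strict_mono_onD[OF assms(3), of p y] by auto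
      then show ?thesis using 3 p by auto
    qed
  qed
  have "{a..b} = {a..p} \<union> {p..b}" using assms(5,6) by auto
  then have "?h ` {a..b} = ?h ` {a..p} \<union> ?h ` {p..b}" by (simp only: image_Un)
  also have "?h ` {a..p} = \<phi> ` {a..p}" by (rule image_cong) auto
  also have "?h ` {p..b} = \<psi> ` {p..b}" using p by (intro image_cong) auto
  finally show "?h ` {a..b} = {c..d}" using assms(2,4) qq by auto
qed

lemma strict_mono_interval_exists:
  fixes a b c d :: real
  assumes "a < b" "c < d"
  obtains h where "strict_mono_on {a..b} h" "h ` {a..b} = {c..d}"
proof
  let ?k = "(d - c) / (b - a)"
  let ?h = "\<lambda>x. c + ?k * (x - a)"
  have k: "?k > 0" using assms by simp
  show mono: "strict_mono_on {a..b} ?h"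
    using k by (intro strict_mono_onI) (simp add: mult_less_cancel_left_pos del: times_divide_eq_left)
  have ends: "?h a = c" "?h b = d" using assms by auto
  show "?h ` {a..b} = {c..d}"
  proof
    show "?h ` {a..b} \<subseteq> {c..d}"
      using strict_mono_on_leD[OF mono, of a] strict_mono_on_leD[OF mono, of _ b] ends assms
      by force
    show "{c..d} \<subseteq> ?h ` {a..b}"
    proof
      fix y assume "y \<in> {c..d}"
      moreover have "continuous_on {a..b} ?h" by (intro continuous_intros)
      ultimately show "y \<in> ?h ` {a..b}"
        using IVT'[of ?h a y b] ends assms by force
    qed
  qed
qed

text \<open>This supplies the bijection of fundamental domains with one prescribed pair. Increasing
  bijections match end points, hence the equivalence; for interior \<open>p\<close> two bijections
  are glued at \<open>p\<close>.\<close>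

lemma strict_mono_interval_through_point:
  fixes a b c d p q :: real
  assumes "a < b" "c < d" "p \<in> {a..<b}" "q \<in> {c..<d}" "p = a \<longleftrightarrow> q = c"
  obtains h where "strict_mono_on {a..b} h" "h ` {a..b} = {c..d}" "h p = q"
proof (cases "p = a")
  case True
  obtain h where h: "strict_mono_on {a..b} h" "h ` {a..b} = {c..d}"
    using strict_mono_interval_exists assms by blast
  then show ?thesis
    using that strict_mono_image_endpoints[OF h] True assms by auto
next
  case False
  with assms have "a < p" "c < q" "p < b" "q < d" by auto
  then obtain h k where h: "strict_mono_on {a..p} h" "h ` {a..p} = {c..q}"
      and k: "strict_mono_on {p..b} k" "k ` {p..b} = {q..d}"
    using strict_mono_interval_exists by metis
  from strict_mono_on_glue[OF h k] strict_mono_image_endpoints[OF h] \<open>a < p\<close> \<open>p < b\<close>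
  show ?thesis using that[of "\<lambda>x. if x \<le> p then h x else k x"] by auto
qed

text \<open>Conjugacies are built below as sets of pairs. The order equivalence gives monotonicity,
  and also single-valuedness, by comparing two partners of one point both ways. Hence no choice of a
  representation \<open>x = (F ^^ n) z\<close> has to be justified.\<close>

lemma order_relation_function:
  fixes R :: "('a::linorder \<times> 'b::linorder) set"
  assumes iff: "\<And>x y x' y'. (x, y) \<in> R \<Longrightarrow> (x', y') \<in> R \<Longrightarrow> x < x' \<longleftrightarrow> y < y'"
  obtains \<phi> where "strict_mono_on (Domain R) \<phi>" "\<phi> ` Domain R = Range R"
    "\<And>x y. (x, y) \<in> R \<Longrightarrow> \<phi> x = y"
proof
  let ?\<phi> = "\<lambda>x. THE y. (x, y) \<in> R"
  have unique: "y = y'" if "(x, y) \<in> R" "(x, y') \<in> R" for x y y'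
    using iff[OF that] iff[OF that(2,1)] by auto
  show eq: "?\<phi> x = y" if "(x, y) \<in> R" for x y
    using that unique by blast
  show "strict_mono_on (Domain R) ?\<phi>"
  proof (rule strict_mono_onI)
    fix x x' assume "x \<in> Domain R" "x' \<in> Domain R" "x < x'"
    then obtain y y' where R: "(x, y) \<in> R" "(x', y') \<in> R" by blast
    then have "y < y'" using iff \<open>x < x'\<close> by blast
    then show "?\<phi> x < ?\<phi> x'" using eq R by simp
  qed
  show "?\<phi> ` Domain R = Range R"
    using eq by force
qed

section \<open>Maps descending to the left end point\<close>

definition descending_map :: "real \<Rightarrow> real \<Rightarrow> (real \<Rightarrow> real) \<Rightarrow> bool"
  where "descending_map a t F \<longleftrightarrow>
    a < t \<and> strict_mono_on {a..t} F \<and> F ` {a..t} = {a..F t} \<and> F t \<le> t \<and> (\<forall>x\<in>{a<..<t}. F x < x)"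

context
  fixes a t :: real and F :: "real \<Rightarrow> real"
  assumes F: "descending_map a t F"
begin

lemma descending_map_lt: "a < t"
  using F by (simp add: descending_map_def)

lemma descending_map_fix: "F a = a"
  using F strict_mono_image_endpoints(1)[of a t F a "F t"] by (simp add: descending_map_def)

lemma descending_map_le: "x \<in> {a..t} \<Longrightarrow> F x \<le> x"
  using F descending_map_fix unfolding descending_map_def
  by (metis atLeastAtMost_iff greaterThanLessThan_iff less_eq_real_def)

text \<open>The two claims share one induction: finding the image of \<open>{a..F t}\<close> under
  \<open>F ^^ n\<close> takes both the monotonicity of \<open>F ^^ n\<close> and its image of
  \<open>{a..t}\<close>.\<close>

lemma descending_map_funpow_mono: "strict_mono_on {a..t} (F ^^ n)"
  and descending_map_funpow_image: "(F ^^ n) ` {a..t} = {a..(F ^^ n) t}"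
proof (induction n)
  case 0
  show "strict_mono_on {a..t} (F ^^ 0)" "(F ^^ 0) ` {a..t} = {a..(F ^^ 0) t}"
    by (auto intro: strict_mono_onI)
next
  case (Suc n)
  have mono: "strict_mono_on {a..t} F" and im: "F ` {a..t} = {a..F t}" and "F t \<le> t" "a < t"
    using F by (auto simp: descending_map_def)
  then have Ft: "F t \<in> {a..t}" by force
  show "strict_mono_on {a..t} (F ^^ Suc n)"
  proof (rule strict_mono_onI)
    fix x y assume xy: "x \<in> {a..t}" "y \<in> {a..t}" "x < y"
    then have "F x < F y" using strict_mono_onD[OF mono] by blast
    moreover have "F x \<in> {a..t}" "F y \<in> {a..t}"
      using im xy \<open>F t \<le> t\<close> by (metis atLeastAtMost_iff imageI order_trans)+
    ultimately have "(F ^^ n) (F x) < (F ^^ n) (F y)"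
      using strict_mono_onD[OF Suc.IH(1)] by blast
    then show "(F ^^ Suc n) x < (F ^^ Suc n) y" by (simp add: funpow_swap1)
  qed
  have "(F ^^ Suc n) ` {a..t} = (F ^^ n) ` {a..F t}"
    unfolding im[symmetric] by (simp add: image_comp funpow_Suc_right del: funpow.simps)
  also have "\<dots> = {a..(F ^^ n) (F t)}"
  proof
    have fix_a: "(F ^^ n) a = a"
      using strict_mono_image_endpoints(1)[OF Suc.IH] \<open>a < t\<close> by simp
    show "(F ^^ n) ` {a..F t} \<subseteq> {a..(F ^^ n) (F t)}"
    proof
      fix y assume "y \<in> (F ^^ n) ` {a..F t}"
      then obtain x where "x \<in> {a..F t}" "y = (F ^^ n) x" by auto
      then show "y \<in> {a..(F ^^ n) (F t)}"
        using strict_mono_on_leD[OF Suc.IH(1), of a x] strict_mono_on_leD[OF Suc.IH(1), of x "F t"]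
          Ft fix_a by auto
    qed
    show "{a..(F ^^ n) (F t)} \<subseteq> (F ^^ n) ` {a..F t}"
    proof
      fix y assume y: "y \<in> {a..(F ^^ n) (F t)}"
      have "(F ^^ n) (F t) \<in> {a..(F ^^ n) t}" using Suc.IH(2) Ft by blast
      then have "y \<in> (F ^^ n) ` {a..t}" using y Suc.IH(2) by auto
      then obtain x where "x \<in> {a..t}" "y = (F ^^ n) x" by auto
      then show "y \<in> (F ^^ n) ` {a..F t}"
        using strict_mono_on_less_eq[OF Suc.IH(1), of x "F t"] Ft y by auto
    qed
  qed
  finally show "(F ^^ Suc n) ` {a..t} = {a..(F ^^ Suc n) t}" by (simp add: funpow_swap1)
qed

lemma descending_map_funpow_in: "x \<in> {a..t} \<Longrightarrow> (F ^^ n) x \<in> {a..t}"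
proof (induction n)
  case (Suc n)
  then have "(F ^^ n) x \<in> {a..t}" by simp
  moreover from this have "F ((F ^^ n) x) \<in> {a..F t}"
    using F by (metis descending_map_def imageI)
  ultimately show ?case using F by (auto simp: descending_map_def)
qed simp

lemma descending_map_funpow_decreasing:
  assumes "x \<in> {a..t}" "m \<le> n"
  shows "(F ^^ n) x \<le> (F ^^ m) x"
  using \<open>m \<le> n\<close>
proof (induction n rule: dec_induct)
  case (step n)
  have "(F ^^ Suc n) x \<le> (F ^^ n) x"
    using descending_map_le[OF descending_map_funpow_in[OF assms(1)]] by simp
  then show ?case using step.IH by linarith
qed simp

lemma descending_map_funpow_fix: "(F ^^ n) a = a"
  by (induction n) (auto simp: descending_map_fix)

text \<open>If the orbit never fell below \<open>y\<close>, its infimum \<open>z\<close> would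
  exceed \<open>a\<close> and have a preimage \<open>w > z\<close>. The orbit drops below
  \<open>w\<close>, hence one step later below \<open>z\<close>, which is absurd.\<close>

lemma descending_map_funpow_limit:
  assumes x: "x \<in> {a..t}" "F x < x" and y: "a < y"
  obtains n where "(F ^^ n) x < y"
proof (rule ccontr)
  assume "\<not> thesis"
  then have ge: "y \<le> (F ^^ n) x" for n using that by (meson not_le)
  have bdd: "bdd_below (range (\<lambda>n. (F ^^ n) x))" using ge by (intro bdd_belowI[of _ y]) auto
  define z where "z = (INF n. (F ^^ n) x)"
  have z: "z \<le> (F ^^ n) x" for n unfolding z_def by (rule cINF_lower[OF bdd]) simp
  have yz: "y \<le> z" unfolding z_def by (rule cINF_greatest) (use ge in auto)
  have mono: "strict_mono_on {a..t} F" and im: "F ` {a..t} = {a..F t}"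
    using F by (auto simp: descending_map_def)
  have "z \<le> F x" using z[of 1] by simp
  also have "\<dots> \<le> F t" using strict_mono_on_leD[OF mono, of x t] x by auto
  finally have "z \<in> F ` {a..t}" unfolding im using y yz by simp
  then obtain w where w: "w \<in> {a..t}" "F w = z" by blast
  \<comment> \<open>Since \<open>t\<close> may be a fixed point, the case \<open>w = t\<close>
    relies on the strict descent of \<open>x\<close> instead.\<close>
  have "z < w"
  proof (cases "w = t")
    case True
    then have "x \<le> w" using x by simp
    then show ?thesis using x(2) \<open>z \<le> F x\<close> by simp
  next
    case False
    moreover have "w \<noteq> a" using w y yz descending_map_fix by auto
    ultimately show ?thesis using w F by (auto simp: descending_map_def)
  qed
  then obtain n where "(F ^^ n) x < w"
    unfolding z_def using cINF_less_iff[OF _ bdd] by auto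
  then have "F ((F ^^ n) x) < z"
    using strict_mono_onD[OF mono descending_map_funpow_in[OF x(1)] w(1)] w(2) by blast
  then show False using z[of "Suc n"] by simp
qed

text \<open>The sets \<open>F\<^sup>n {F t<..t}\<close> tile \<open>{a<..t}\<close>, in decreasing order of \<open>n\<close>.\<close>

lemma descending_map_tiles_less:
  assumes z: "z \<in> {F t<..t}" "z' \<in> {F t<..t}"
  shows "(F ^^ n) z < (F ^^ m) z' \<longleftrightarrow> m < n \<or> n = m \<and> z < z'"
proof -
  have Ft: "F t \<in> {a..t}" using descending_map_funpow_in[of t 1] descending_map_lt by simp
  \<comment> \<open>The point \<open>(F ^^ Suc m) t\<close> separates the tiles: all of tile
    \<open>n\<close> lies at or below it, all of tile \<open>m\<close> strictly above it.\<close>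
  have earlier: "(F ^^ n) z < (F ^^ m) z'" if z: "z \<in> {F t<..t}" "z' \<in> {F t<..t}" and "m < n" for n m z z'
  proof -
    have in_at: "z \<in> {a..t}" "z' \<in> {a..t}" "t \<in> {a..t}" using z Ft by auto
    have "(F ^^ n) z \<le> (F ^^ n) t"
      using strict_mono_on_leD[OF descending_map_funpow_mono in_at(1,3)] z by simp
    also have "\<dots> \<le> (F ^^ Suc m) t"
      using descending_map_funpow_decreasing[OF in_at(3), of "Suc m" n] \<open>m < n\<close> by simp
    also have "\<dots> = (F ^^ m) (F t)" by (simp add: funpow_swap1)
    also have "\<dots> < (F ^^ m) z'"
      using strict_mono_onD[OF descending_map_funpow_mono Ft in_at(2)] z by simp
    finally show ?thesis .
  qed
  have same: "(F ^^ n) z < (F ^^ n) z' \<longleftrightarrow> z < z'"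
    using strict_mono_on_less[OF descending_map_funpow_mono, of z z' n] z Ft by auto
  consider "m < n" | "n < m" | "n = m" by linarith
  then show ?thesis
    using earlier[OF z, of m n] earlier[OF z(2,1), of n m] same by cases auto
qed

text \<open>Let \<open>n\<close> be the first index with \<open>(F ^^ n) t < x\<close>. It is
  positive because \<open>x \<le> t\<close>, so \<open>x\<close> lies between two consecutive
  iterates of \<open>t\<close> and hence in the tile with index \<open>n - 1\<close>.\<close>

lemma descending_map_tiles_cover:
  assumes x: "x \<in> {a<..t}" and "F t < t"
  obtains n z where "z \<in> {F t<..t}" "x = (F ^^ n) z"
proof -
  have t: "t \<in> {a..t}" using descending_map_lt by simp
  have "\<exists>n. (F ^^ n) t < x"
    using descending_map_funpow_limit[OF t \<open>F t < t\<close>] x by (metis greaterThanAtMost_iff)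
  then obtain n where n: "(F ^^ n) t < x" "\<And>k. k < n \<Longrightarrow> \<not> (F ^^ k) t < x"
    using exists_least_iff[of "\<lambda>n. (F ^^ n) t < x"] by auto
  have "n \<noteq> 0" using n(1) x by (cases n) auto
  then obtain m where m: "n = Suc m" by (cases n) auto
  have "x \<in> (F ^^ m) ` {a..t}"
    using n(2)[of m] m x by (simp add: descending_map_funpow_image)
  then obtain z where z: "z \<in> {a..t}" "x = (F ^^ m) z" by blast
  have "(F ^^ m) (F t) < (F ^^ m) z"
    using n(1) m z(2) by (simp add: funpow_swap1)
  then have "F t < z"
    using strict_mono_on_less[OF descending_map_funpow_mono _ z(1), of "F t" m]
      descending_map_funpow_in[OF t, of 1] by simp
  then show ?thesis using that z by auto
qed

text \<open>Below an interior point the descent is strict at the new upper end as well, so even a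
  map fixing \<open>t\<close> contains a shrinking one.\<close>

lemma descending_map_restrict:
  assumes "x \<in> {a<..<t}"
  shows "descending_map a x F" "F x < x"
proof -
  have mono: "strict_mono_on {a..t} F" and im: "F ` {a..t} = {a..F t}" and less: "\<forall>x\<in>{a<..<t}. F x < x"
    using F by (auto simp: descending_map_def)
  show "F x < x" using less assms by blast
  have "F ` {a..x} = {a..F x}"
  proof
    show "F ` {a..x} \<subseteq> {a..F x}"
    proof
      fix y assume "y \<in> F ` {a..x}"
      then obtain w where w: "w \<in> {a..x}" "y = F w" by blast
      then have "y \<in> F ` {a..t}" using assms by auto
      then show "y \<in> {a..F x}" using w im assms strict_mono_on_leD[OF mono, of w x] by auto
    qed
    show "{a..F x} \<subseteq> F ` {a..x}"
    proof
      fix y assume y: "y \<in> {a..F x}"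
      moreover have "F x \<le> F t" using assms strict_mono_on_leD[OF mono, of x t] by auto
      ultimately have "y \<in> F ` {a..t}" using im by auto
      then obtain w where "w \<in> {a..t}" "y = F w" by blast
      then show "y \<in> F ` {a..x}"
        using y assms strict_mono_on_less_eq[OF mono, of w x] by auto
    qed
  qed
  moreover have "strict_mono_on {a..x} F"
    using mono assms by (auto intro: monotone_on_subset)
  ultimately show "descending_map a x F"
    using assms less unfolding descending_map_def by force
qed

end

section \<open>Conjugacies between descending maps\<close>

text \<open>A bijection \<open>h\<close> of the fundamental domains extends along the tiles, since
  \<open>F\<close> and \<open>G\<close> order their tiles by the same rule. The pair
  \<open>p\<close>, \<open>q\<close> is kept free so that the value of a map at its jump can be
  matched later.\<close>

lemma descending_map_conjugate_shrinking:
  assumes F: "descending_map a t F" "F t < t" and G: "descending_map c s G" "G s < s"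
    and p: "p \<in> {F t..<t}" and q: "q \<in> {G s..<s}" and pq: "p = F t \<longleftrightarrow> q = G s"
  obtains \<phi> where "order_conjugacy a t F c s G \<phi>" "\<phi> p = q"
proof -
  note at = descending_map_lt[OF F(1)] and cs = descending_map_lt[OF G(1)]
  obtain h where h: "strict_mono_on {F t..t} h" "h ` {F t..t} = {G s..s}" "h p = q"
    using strict_mono_interval_through_point[OF F(2) G(2) p q pq] by blast
  have h_ends: "h (F t) = G s" "h t = s"
    using strict_mono_image_endpoints[OF h(1,2)] F(2) by auto
  have h_less: "h z < h z' \<longleftrightarrow> z < z'" if "z \<in> {F t<..t}" "z' \<in> {F t<..t}" for z z'
    using strict_mono_on_less[OF h(1)] that by simp
  have h_in: "h z \<in> {G s<..s}" if "z \<in> {F t<..t}" for z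
  proof -
    have "h (F t) < h z" "h z \<in> {G s..s}" using strict_mono_onD[OF h(1)] h(2) that by auto
    then show ?thesis using h_ends by simp
  qed
  have h_surj: "\<exists>z\<in>{F t<..t}. h z = w" if "w \<in> {G s<..s}" for w
  proof -
    have "w \<in> h ` {F t..t}" using h(2) that by auto
    then obtain z where "z \<in> {F t..t}" "w = h z" by blast
    moreover then have "z \<noteq> F t" using h_ends that by auto
    ultimately show ?thesis by force
  qed
  \<comment> \<open>The pair \<open>(a, c)\<close> is added by hand because no tile contains the
    lower end point.\<close>
  define R where "R = insert (a, c) {((F ^^ n) z, (G ^^ n) (h z)) |n z. z \<in> {F t<..t}}"
  \<comment> \<open>The names are rebound so that the claim applies to \<open>G\<close> as well as
    to \<open>F\<close>.\<close>
  have tile_gt: "a < (F ^^ n) z" if "descending_map a t F" "z \<in> {F t<..t}" for a t F n z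
    using strict_mono_onD[OF descending_map_funpow_mono[OF that(1)], of a z n]
      descending_map_funpow_fix[OF that(1)] descending_map_lt[OF that(1)] that(2)
      descending_map_funpow_in[OF that(1), of t 1] by simp
  have tile_F: "a < (F ^^ n) z" and tile_G: "c < (G ^^ n) (h z)" if "z \<in> {F t<..t}" for n z
    using tile_gt[OF F(1)] tile_gt[OF G(1)] that h_in by blast+
  have iff: "x < x' \<longleftrightarrow> y < y'" if "(x, y) \<in> R" "(x', y') \<in> R" for x y x' y'
  proof -
    have tiles: "(F ^^ n) z < (F ^^ m) z' \<longleftrightarrow> (G ^^ n) (h z) < (G ^^ m) (h z')"
      if z: "z \<in> {F t<..t}" "z' \<in> {F t<..t}" for n m z z'
      unfolding descending_map_tiles_less[OF F(1) z]
        descending_map_tiles_less[OF G(1) h_in[OF z(1)] h_in[OF z(2)]] h_less[OF z] ..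
    have no_lower: "\<not> (F ^^ n) z < a" "\<not> (G ^^ n) (h z) < c" if "z \<in> {F t<..t}" for n z
      using tile_F[OF that] tile_G[OF that] by (auto simp: not_less intro: less_imp_le)
    from that consider "(x, y) = (a, c)" "(x', y') = (a, c)"
      | n z where "(x, y) = (a, c)" "z \<in> {F t<..t}" "(x', y') = ((F ^^ n) z, (G ^^ n) (h z))"
      | n z where "(x', y') = (a, c)" "z \<in> {F t<..t}" "(x, y) = ((F ^^ n) z, (G ^^ n) (h z))"
      | n z m z' where "z \<in> {F t<..t}" "z' \<in> {F t<..t}" "(x, y) = ((F ^^ n) z, (G ^^ n) (h z))"
          "(x', y') = ((F ^^ m) z', (G ^^ m) (h z'))"
      unfolding R_def by blast
    then show ?thesis
      by cases (use tile_F tile_G no_lower tiles in \<open>simp_all del: greaterThanAtMost_iff\<close>)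
  qed
  obtain \<phi> where \<phi>: "strict_mono_on (Domain R) \<phi>" "\<phi> ` Domain R = Range R"
      "\<And>x y. (x, y) \<in> R \<Longrightarrow> \<phi> x = y"
    using order_relation_function[OF iff] by blast
  have tile_le: "(F ^^ n) z \<le> t" if "descending_map a t F" "z \<in> {F t<..t}" for a t F n z
    using tile_gt[OF that(1), of z 0] descending_map_funpow_in[OF that(1), of z n] that by simp
  have dom: "Domain R = {a..t}"
  proof
    show "Domain R \<subseteq> {a..t}"
      unfolding R_def using at less_imp_le[OF tile_F] tile_le[OF F(1)] by auto
    show "{a..t} \<subseteq> Domain R"
    proof
      fix x assume "x \<in> {a..t}"
      then consider "x = a" | "x \<in> {a<..t}" by force
      then show "x \<in> Domain R"
      proof cases
        case 2
        then obtain n z where "z \<in> {F t<..t}" "x = (F ^^ n) z"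
          using descending_map_tiles_cover[OF F(1) _ F(2)] by blast
        then show ?thesis unfolding R_def by blast
      qed (auto simp: R_def)
    qed
  qed
  have ran: "Range R = {c..s}"
  proof
    show "Range R \<subseteq> {c..s}"
      unfolding R_def using cs less_imp_le[OF tile_G] tile_le[OF G(1) h_in] by auto
    show "{c..s} \<subseteq> Range R"
    proof
      fix y assume "y \<in> {c..s}"
      then consider "y = c" | "y \<in> {c<..s}" by force
      then show "y \<in> Range R"
      proof cases
        case 2
        then obtain n w where "w \<in> {G s<..s}" "y = (G ^^ n) w"
          using descending_map_tiles_cover[OF G(1) _ G(2)] by blast
        moreover then obtain z where "z \<in> {F t<..t}" "h z = w" using h_surj by blast
        ultimately show ?thesis unfolding R_def by blast
      qed (auto simp: R_def)
    qed
  qed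
  \<comment> \<open>Closure of \<open>R\<close> under applying both maps is exactly the conjugacy
    equation.\<close>
  have step: "(F x, G y) \<in> R" if xy: "(x, y) \<in> R" for x y
  proof (cases "(x, y) = (a, c)")
    case True
    then show ?thesis
      by (simp add: R_def descending_map_fix[OF F(1)] descending_map_fix[OF G(1)])
  next
    case False
    then obtain n z where "x = (F ^^ n) z" "y = (G ^^ n) (h z)" "z \<in> {F t<..t}"
      using xy unfolding R_def by blast
    then have "F x = (F ^^ Suc n) z" "G y = (G ^^ Suc n) (h z)" by auto
    then show ?thesis unfolding R_def using \<open>z \<in> {F t<..t}\<close> by blast
  qed
  have "\<phi> (F x) = G (\<phi> x)" if "x \<in> {a..t}" for x
  proof -
    from that have "x \<in> Domain R" by (simp add: dom)
    then obtain y where y: "(x, y) \<in> R" by (rule DomainE)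
    show ?thesis using \<phi>(3)[OF y] \<phi>(3)[OF step[OF y]] by simp
  qed
  then have "order_conjugacy a t F c s G \<phi>"
    using \<phi>(1,2) dom ran unfolding order_conjugacy_def by simp
  moreover have "(p, q) \<in> R"
  proof (cases "p = F t")
    \<comment> \<open>Here \<open>p\<close> is the excluded left end of the fundamental domain; it
      is reached by one step from the pair \<open>(t, s)\<close>.\<close>
    case True
    have "(t, s) \<in> R"
      unfolding R_def using F(2) h_ends by (auto intro!: exI[of _ 0] exI[of _ t])
    then show ?thesis using step True pq by auto
  next
    case False
    then have "p \<in> {F t<..t}" using p by auto
    then show ?thesis
      unfolding R_def using h(3) by (auto intro!: exI[of _ 0] exI[of _ p])
  qed
  ultimately show ?thesis using that \<phi>(3) by blast
qed

text \<open>A conjugacy near the lower end point extends upwards by pulling it back along iterates.\<close>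

lemma descending_map_conjugate_fixing:
  assumes F: "descending_map a t F" "F t = t" and G: "descending_map c s G" "G s = s"
  obtains \<phi> where "order_conjugacy a t F c s G \<phi>"
proof -
  note at = descending_map_lt[OF F(1)] and cs = descending_map_lt[OF G(1)]
  obtain x0 where x0: "x0 \<in> {a<..<t}" using dense[OF at] by auto
  obtain y0 where y0: "y0 \<in> {c<..<s}" using dense[OF cs] by auto
  note F0 = descending_map_restrict[OF F(1) x0] and G0 = descending_map_restrict[OF G(1) y0]
  obtain \<phi>0 where "order_conjugacy a x0 F c y0 G \<phi>0"
    \<comment> \<open>Any admissible pair would do; the left ends of the two fundamental domains
      satisfy the equivalence trivially.\<close>
    using descending_map_conjugate_shrinking[OF F0 G0, of "F x0" "G y0"] F0 G0 by auto
  then have mono0: "strict_mono_on {a..x0} \<phi>0" and im0: "\<phi>0 ` {a..x0} = {c..y0}"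
      and conj0: "\<And>x. x \<in> {a..x0} \<Longrightarrow> \<phi>0 (F x) = G (\<phi>0 x)"
    by (auto simp: order_conjugacy_def)
  \<comment> \<open>A pair is accepted when its \<open>n\<close>-th iterates correspond under
    \<open>\<phi>0\<close>. The index must be large enough to bring \<open>x\<close> into
    \<open>{a..x0}\<close>, and the fixed upper ends, which never get there, are left out.\<close>
  define S where "S = (\<lambda>n x y. x \<in> {a..<t} \<and> y \<in> {c..<s} \<and> (F ^^ n) x \<in> {a..x0} \<and>
    \<phi>0 ((F ^^ n) x) = (G ^^ n) y)"
  have S_Suc: "S (Suc n) x y" if "S n x y" for n x y
    using that conj0 descending_map_le[OF F0(1), of "(F ^^ n) x"]
      descending_map_funpow_in[OF F0(1), of "(F ^^ n) x" 1]
    unfolding S_def by auto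
  have S_mono: "S n x y" if "S m x y" "m \<le> n" for m n x y
    using that(2,1) by (induction n rule: dec_induct) (auto intro: S_Suc)
  define R where "R = insert (t, s) {(x, y). \<exists>n. S n x y}"
  have S_less: "x < x' \<longleftrightarrow> y < y'" if S: "S n x y" "S m x' y'" for n m x y x' y'
  proof -
    \<comment> \<open>At a common index the iterates are comparable, because \<open>F ^^ N\<close>,
      \<open>\<phi>0\<close> and \<open>G ^^ N\<close> all preserve and reflect order.\<close>
    define N where "N = max n m"
    have N: "S N x y" "S N x' y'"
      using S S_mono[OF _ max.cobounded1] S_mono[OF _ max.cobounded2] unfolding N_def by blast+
    have "x < x' \<longleftrightarrow> (F ^^ N) x < (F ^^ N) x'"
      using N strict_mono_on_less[OF descending_map_funpow_mono[OF F(1)], of x x' N]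
      unfolding S_def by auto
    also have "\<dots> \<longleftrightarrow> (G ^^ N) y < (G ^^ N) y'"
      using N strict_mono_on_less[OF mono0, of "(F ^^ N) x" "(F ^^ N) x'"]
      unfolding S_def by auto
    also have "\<dots> \<longleftrightarrow> y < y'"
      using N strict_mono_on_less[OF descending_map_funpow_mono[OF G(1)], of y y' N]
      unfolding S_def by auto
    finally show ?thesis .
  qed
  have S_lt: "x < t" "y < s" if "S n x y" for n x y
    using that by (auto simp: S_def)
  have iff: "x < x' \<longleftrightarrow> y < y'" if "(x, y) \<in> R" "(x', y') \<in> R" for x y x' y'
    using that unfolding R_def by (auto dest: S_less S_lt order_less_imp_not_less)
  obtain \<phi> where \<phi>: "strict_mono_on (Domain R) \<phi>" "\<phi> ` Domain R = Range R"
      "\<And>x y. (x, y) \<in> R \<Longrightarrow> \<phi> x = y"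
    using order_relation_function[OF iff] by blast
  have reach: "\<exists>n. (F ^^ n) x \<in> {a..x0}"
    if F: "descending_map a t F" and x0: "x0 \<in> {a<..<t}" and x: "x \<in> {a..<t}" for a t F x0 x
  proof (cases "x = a")
    case True
    then show ?thesis using x0 by (auto intro: exI[of _ 0])
  next
    case False
    then have "F x < x" using descending_map_restrict(2)[OF F] x by auto
    then obtain n where "(F ^^ n) x < x0"
      using descending_map_funpow_limit[OF F, of x x0] x x0 by auto
    then show ?thesis
      using descending_map_funpow_in[OF F, of x n] x by (intro exI[of _ n]) auto
  qed
  have t_fix: "(F ^^ n) t = t" and s_fix: "(G ^^ n) s = s" for n
    using F(2) G(2) by (induction n) auto
  have dom: "Domain R = {a..t}"
  proof
    show "Domain R \<subseteq> {a..t}" unfolding R_def S_def using at by auto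
    show "{a..t} \<subseteq> Domain R"
    proof
      fix x assume "x \<in> {a..t}"
      then consider "x = t" | "x \<in> {a..<t}" by force
      then show "x \<in> Domain R"
      proof cases
        case 2
        then obtain n where n: "(F ^^ n) x \<in> {a..x0}" using reach[OF F(1) x0] by blast
        then have "\<phi>0 ((F ^^ n) x) \<in> {c..y0}" using im0 by blast
        \<comment> \<open>Since \<open>s\<close> is fixed, \<open>G ^^ n\<close> maps
          \<open>{c..s}\<close> onto itself, so the partner of \<open>x\<close> can be pulled
          back.\<close>
        then have "\<phi>0 ((F ^^ n) x) \<in> (G ^^ n) ` {c..s}" and lt: "\<phi>0 ((F ^^ n) x) < s"
          using y0 by (auto simp: descending_map_funpow_image[OF G(1)] s_fix)
        then obtain y where y: "y \<in> {c..s}" "\<phi>0 ((F ^^ n) x) = (G ^^ n) y" by blast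
        moreover have "y \<noteq> s" using y(2) lt s_fix by auto
        ultimately have "S n x y" using 2 n by (auto simp: S_def)
        then show ?thesis unfolding R_def by blast
      qed (auto simp: R_def)
    qed
  qed
  have ran: "Range R = {c..s}"
  proof
    show "Range R \<subseteq> {c..s}" unfolding R_def S_def using cs by auto
    show "{c..s} \<subseteq> Range R"
    proof
      fix y assume "y \<in> {c..s}"
      then consider "y = s" | "y \<in> {c..<s}" by force
      then show "y \<in> Range R"
      proof cases
        case 2
        then obtain n where "(G ^^ n) y \<in> {c..y0}" using reach[OF G(1) y0] by blast
        then obtain u where u: "u \<in> {a..x0}" "\<phi>0 u = (G ^^ n) y" using im0 by force
        then have "u \<in> (F ^^ n) ` {a..t}"
          using x0 by (auto simp: descending_map_funpow_image[OF F(1)] t_fix)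
        then obtain x where x: "x \<in> {a..t}" "u = (F ^^ n) x" by blast
        moreover have "x \<noteq> t" using x(2) u(1) x0 t_fix by auto
        ultimately have "S n x y" using 2 u by (auto simp: S_def)
        then show ?thesis unfolding R_def by blast
      qed (auto simp: R_def)
    qed
  qed
  have step: "(F x, G y) \<in> R" if xy: "(x, y) \<in> R" for x y
  proof (cases "(x, y) = (t, s)")
    case True
    then show ?thesis using F(2) G(2) by (simp add: R_def)
  next
    case False
    then obtain n where "S n x y" using xy unfolding R_def by blast
    \<comment> \<open>Raising the index first allows one application of the maps to be split off,
      which leaves index \<open>n\<close> for \<open>F x\<close> and \<open>G y\<close>.\<close>
    then have S: "S (Suc n) x y" by (rule S_Suc)
    then have "x \<in> {a..<t}" "y \<in> {c..<s}" by (auto simp: S_def)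
    then have "F x \<in> {a..<t}" "G y \<in> {c..<s}"
      using descending_map_le[OF F(1), of x] descending_map_le[OF G(1), of y]
        descending_map_funpow_in[OF F(1), of x 1] descending_map_funpow_in[OF G(1), of y 1]
      by auto
    then have "S n (F x) (G y)" using S by (simp add: S_def funpow_swap1)
    then show ?thesis unfolding R_def by blast
  qed
  have "\<phi> (F x) = G (\<phi> x)" if "x \<in> {a..t}" for x
  proof -
    from that have "x \<in> Domain R" by (simp add: dom)
    then obtain y where y: "(x, y) \<in> R" by (rule DomainE)
    show ?thesis using \<phi>(3)[OF y] \<phi>(3)[OF step[OF y]] by simp
  qed
  then have "order_conjugacy a t F c s G \<phi>"
    using \<phi>(1,2) dom ran unfolding order_conjugacy_def by simp
  then show ?thesis using that by blast
qed

section \<open>Maps with a jump\<close>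

text \<open>The two image equations carry everything that is needed of the continuity of \<open>f\<close> off \<open>t\<close> and of
  its one-sided limits.\<close>

definition jump_map :: "real \<Rightarrow> real \<Rightarrow> real \<Rightarrow> real \<Rightarrow> real \<Rightarrow> (real \<Rightarrow> real) \<Rightarrow> bool"
  where "jump_map a b t l r f \<longleftrightarrow>
    a < t \<and> t < b \<and> f a = a \<and> f b = b \<and> strict_mono_on {a..b} f \<and>
    f ` {a..<t} = {a..<l} \<and> f ` {t<..b} = {r<..b} \<and>
    (\<forall>x\<in>{a<..<t}. f x < x) \<and> (\<forall>x\<in>{t<..<b}. x < f x) \<and>
    l \<le> f t \<and> f t \<le> r \<and> f t \<noteq> t"

text \<open>This is conjugation by the reflection in the origin. It turns the part of a map to the
  right of its jump into a part to the left of a jump.\<close>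

definition reflect :: "(real \<Rightarrow> real) \<Rightarrow> real \<Rightarrow> real"
  where "reflect f x = - f (- x)"

lemma strict_mono_on_reflect:
  "strict_mono_on {a..b} f \<Longrightarrow> strict_mono_on {- b..- a} (reflect f)"
  by (auto simp: reflect_def strict_mono_on_def)

lemma reflect_image: "reflect f ` A = uminus ` f ` uminus ` A"
  by (simp add: image_image reflect_def)

lemma jump_map_reflect:
  assumes "jump_map a b t l r f"
  shows "jump_map (- b) (- a) (- t) (- r) (- l) (reflect f)"
proof -
  have "strict_mono_on {- b..- a} (reflect f)"
    using assms strict_mono_on_reflect by (simp add: jump_map_def)
  moreover have "reflect f ` {- b..<- t} = {- b..<- r}" "reflect f ` {- t<..- a} = {- l<..- a}"
    using assms by (simp_all add: reflect_image jump_map_def)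
  moreover have "\<forall>x\<in>{- b<..<- t}. reflect f x < x" "\<forall>x\<in>{- t<..<- a}. x < reflect f x"
  proof -
    have "f z < z" if "z \<in> {a<..<t}" for z using assms that by (simp add: jump_map_def)
    from this[of "- x" for x] show "\<forall>x\<in>{- t<..<- a}. x < reflect f x"
      by (simp add: reflect_def less_minus_iff)
    have "z < f z" if "z \<in> {t<..<b}" for z using assms that by (simp add: jump_map_def)
    from this[of "- x" for x] show "\<forall>x\<in>{- b<..<- t}. reflect f x < x"
      by (simp add: reflect_def minus_less_iff)
  qed
  ultimately show ?thesis
    using assms by (simp add: jump_map_def reflect_def)
qed

text \<open>Replacing the value at \<open>t\<close> by the left limit closes the image. The bound
  \<open>l \<le> t\<close> holds because otherwise \<open>t\<close> would be a value
  \<open>f x\<close> with \<open>x < t\<close>, against \<open>f x \<le> x\<close>.\<close>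

lemma jump_map_descending:
  assumes "jump_map a b t l r f"
  shows "descending_map a t (\<lambda>x. if x < t then f x else l)"
proof -
  let ?F = "\<lambda>x. if x < t then f x else l"
  have "a < t" "t < b" "f a = a" and mono: "strict_mono_on {a..b} f"
    and im: "f ` {a..<t} = {a..<l}" and less: "\<forall>x\<in>{a<..<t}. f x < x"
    using assms by (auto simp: jump_map_def)
  have lt_l: "f x < l" if "x \<in> {a..<t}" for x
    using im that by auto
  then have "a < l" using \<open>a < t\<close> \<open>f a = a\<close> by fastforce
  have "l \<le> t"
  proof (rule ccontr)
    assume "\<not> l \<le> t"
    then have "t \<in> f ` {a..<t}" using im \<open>a < t\<close> by auto
    then obtain x where x: "x \<in> {a..<t}" "f x = t" by force
    moreover have "f x \<le> x" using less x(1) \<open>f a = a\<close> by (cases "x = a") force+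
    ultimately show False by auto
  qed
  moreover have "strict_mono_on {a..t} ?F"
    using strict_mono_onD[OF mono] lt_l \<open>t < b\<close> by (intro strict_mono_onI) auto
  moreover have "?F ` {a..t} = {a..l}"
  proof -
    have "{a..t} = insert t {a..<t}" using \<open>a < t\<close> by auto
    then have "?F ` {a..t} = insert (?F t) (?F ` {a..<t})" by (simp only: image_insert)
    also have "?F ` {a..<t} = f ` {a..<t}" by (rule image_cong) auto
    also have "insert (?F t) \<dots> = {a..l}" using im \<open>a < l\<close> by auto
    finally show ?thesis .
  qed
  ultimately show ?thesis
    using \<open>a < t\<close> less by (simp add: descending_map_def)
qed

section \<open>Conjugacy as an equivalence relation, and sufficiency of the criterion\<close>

lemma topologically_conjugate_sym:
  assumes "topologically_conjugate S f T g" "f ` S \<subseteq> S"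
  shows "topologically_conjugate T g S f"
proof -
  obtain \<phi> \<psi> where h: "homeomorphism S T \<phi> \<psi>" and c: "\<forall>x\<in>S. \<phi> (f x) = g (\<phi> x)"
    using assms by (auto simp: topologically_conjugate_def)
  have "\<psi> (g y) = f (\<psi> y)" if "y \<in> T" for y
  proof -
    have "\<psi> y \<in> S" "\<phi> (\<psi> y) = y"
      using h that by (auto simp: homeomorphism_def)
    moreover from this have "f (\<psi> y) \<in> S" using assms(2) by blast
    ultimately show ?thesis using c h by (metis homeomorphism_apply1)
  qed
  then show ?thesis
    using homeomorphism_symD[OF h] by (auto simp: topologically_conjugate_def)
qed

lemma topologically_conjugate_trans:
  assumes "topologically_conjugate S f T g" "topologically_conjugate T g U h"
  shows "topologically_conjugate S f U h"
proof -
  obtain \<phi> \<psi> \<phi>' \<psi>' where h: "homeomorphism S T \<phi> \<psi>" "homeomorphism T U \<phi>' \<psi>'"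
    and c: "\<forall>x\<in>S. \<phi> (f x) = g (\<phi> x)" "\<forall>x\<in>T. \<phi>' (g x) = h (\<phi>' x)"
    using assms unfolding topologically_conjugate_def by auto
  have "\<forall>x\<in>S. (\<phi>' \<circ> \<phi>) (f x) = h ((\<phi>' \<circ> \<phi>) x)"
    using c h(1) by (auto simp: homeomorphism_def)
  then show ?thesis
    using homeomorphism_compose[OF h] unfolding topologically_conjugate_def by blast
qed

lemma topologically_conjugate_reflect:
  "topologically_conjugate {a..b} f {- b..- a} (reflect f)"
proof -
  have "homeomorphism {a..b} {- b..- a} uminus (uminus :: real \<Rightarrow> real)"
    by (intro homeomorphismI continuous_intros) auto
  then show ?thesis
    unfolding topologically_conjugate_def
    by (intro exI[of _ uminus]) (auto simp: reflect_def)
qed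

text \<open>Conjugacies on the two sides of the jump are glued at \<open>t\<close>. As
  \<open>f t\<close> lies on the lower side, only the lower conjugacy has to respect the value at
  the jump.\<close>

lemma jump_map_conjugate_below:
  assumes f: "jump_map a b t l r f" "f t < t" and g: "jump_map c d s l' r' g" "g s < s"
    and l: "f t = l \<longleftrightarrow> g s = l'" and r: "r = t \<longleftrightarrow> r' = s"
  shows "topologically_conjugate {a..b} f {c..d} g"
proof -
  \<comment> \<open>One scheme gives the modifications of \<open>f\<close> and \<open>g\<close> to
    the left of the jump and, via reflection, to the right.\<close>
  define lower where "lower = (\<lambda>f t l (x::real). if x < t then f x else (l::real))"
  define F where "F = lower f t l"
  define G where "G = lower g s l'"
  define F' where "F' = lower (reflect f) (- t) (- r)"
  define G' where "G' = lower (reflect g) (- s) (- r')"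
  have F: "descending_map a t F" and G: "descending_map c s G"
    using jump_map_descending f(1) g(1) by (auto simp: F_def G_def lower_def)
  have F': "descending_map (- b) (- t) F'" and G': "descending_map (- d) (- s) G'"
    using jump_map_descending[OF jump_map_reflect] f(1) g(1)
    by (auto simp: F'_def G'_def lower_def)
  have ends: "F t = l" "G s = l'" "F' (- t) = - r" "G' (- s) = - r'"
    by (simp_all add: F_def G_def F'_def G'_def lower_def)
  have ab: "a < t" "t < b" "l \<le> f t" "t \<le> r" and cd: "l' \<le> g s" "c < s" "s < d" "s \<le> r'"
    using f g F' G' ends by (auto simp: jump_map_def descending_map_def)
  obtain \<phi> where \<phi>: "order_conjugacy a t F c s G \<phi>" and \<phi>_t: "\<phi> (f t) = g s"
    \<comment> \<open>Here \<open>f t\<close> lies in the half-open interval from \<open>l\<close>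
      to \<open>t\<close>, and it is the left end exactly when \<open>g s = l'\<close>.\<close>
    using descending_map_conjugate_shrinking[OF F _ G, of "f t" "g s"] f(2) g(2) ab cd l ends
    by auto
  obtain \<psi> where \<psi>: "order_conjugacy (- b) (- t) F' (- d) (- s) G' \<psi>"
  \<comment> \<open>In the borderline case the reflected modification fixes its upper end
    \<open>- t\<close>, so there is no fundamental domain. In the other case the left ends of the
    domains serve as the prescribed pair.\<close>
  proof (cases "r = t")
    case True
    then show ?thesis using descending_map_conjugate_fixing[OF F' _ G'] r ends that by auto
  next
    case False
    then show ?thesis
      using descending_map_conjugate_shrinking[OF F' _ G', of "- r" "- r'"] r ends ab cd that
      by auto
  qed
  let ?\<psi> = "reflect \<psi>"
  have \<phi>_mono: "strict_mono_on {a..t} \<phi>" "\<phi> ` {a..t} = {c..s}"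
    and \<psi>_mono: "strict_mono_on {- b..- t} \<psi>" "\<psi> ` {- b..- t} = {- d..- s}"
    using \<phi> \<psi> by (auto simp: order_conjugacy_def)
  have "strict_mono_on {t..b} ?\<psi>" "?\<psi> ` {t..b} = {s..d}"
    using strict_mono_on_reflect[OF \<psi>_mono(1)] \<psi>_mono(2) by (auto simp: reflect_image)
  note glue = strict_mono_on_glue[OF \<phi>_mono this]
  let ?h = "\<lambda>x. if x \<le> t then \<phi> x else ?\<psi> x"
  have at_t: "\<phi> t = s" "\<psi> (- t) = - s"
    using strict_mono_image_endpoints(2)[OF \<phi>_mono] strict_mono_image_endpoints(2)[OF \<psi>_mono] ab
    by auto
  have "?h (f x) = g (?h x)" if x: "x \<in> {a..b}" for x
  proof (rule linorder_cases[of x t])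
    assume "x < t"
    then have "F x = f x" "f x \<le> t"
      using x descending_map_le[OF F, of x] by (auto simp: F_def lower_def)
    moreover have "\<phi> x < s"
      using strict_mono_onD[OF \<phi>_mono(1), of x t] x \<open>x < t\<close> at_t by auto
    moreover have "\<phi> (F x) = G (\<phi> x)"
      using \<phi> x \<open>x < t\<close> by (simp add: order_conjugacy_def)
    ultimately show ?thesis using \<open>x < t\<close> by (simp add: G_def lower_def)
  next
    assume "x = t"
    \<comment> \<open>The glued map sends \<open>t\<close> to \<open>s\<close>, and
      \<open>f t < t\<close> puts \<open>f t\<close> under \<open>\<phi>\<close>, which was chosen
      to send it to \<open>g s\<close>.\<close>
    then show ?thesis using \<phi>_t at_t f(2) by simp
  next
    assume "t < x"
    then have "f x \<in> {r<..b}" using f(1) x by (auto simp: jump_map_def)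
    then have "f x > t" using ab by auto
    have "F' (- x) = - f x" using \<open>t < x\<close> by (simp add: F'_def lower_def reflect_def)
    moreover have "\<psi> (- x) < - s"
      using strict_mono_onD[OF \<psi>_mono(1), of "- x" "- t"] x \<open>t < x\<close> at_t by auto
    moreover have "\<psi> (F' (- x)) = G' (\<psi> (- x))"
      using \<psi> x \<open>t < x\<close> by (simp add: order_conjugacy_def)
    ultimately show ?thesis
      using \<open>t < x\<close> \<open>f x > t\<close> by (simp add: G'_def lower_def reflect_def)
  qed
  then have "order_conjugacy a b f c d g ?h"
    using glue ab unfolding order_conjugacy_def by auto
  then show ?thesis by (rule order_conjugacy_topologically_conjugate)
qed

text \<open>After a reflection \<open>f t < t\<close>; then \<open>f t = r\<close> is impossible, and \<open>l = t\<close> as well.\<close>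

lemma jump_map_normalize:
  assumes f: "jump_map a b t l r f"
  obtains a' b' t' l' r' f' where "jump_map a' b' t' l' r' f'" "f' t' < t'"
    "topologically_conjugate {a..b} f {a'..b'} f'"
    "f' t' = l' \<longleftrightarrow> \<not> (l < f t \<and> f t < r)" "r' = t' \<longleftrightarrow> l = t \<or> r = t"
proof -
  have le: "l \<le> t" "t \<le> r" and ft: "l \<le> f t" "f t \<le> r" "f t \<noteq> t"
    using jump_map_descending[OF f] jump_map_descending[OF jump_map_reflect[OF f]] f
    by (auto simp: descending_map_def jump_map_def)
  show ?thesis
  proof (cases "f t < t")
    case True
    have "topologically_conjugate {a..b} f {a..b} f"
      using homeomorphism_ident unfolding topologically_conjugate_def by fastforce
    then show ?thesis using that[OF f True] le ft True by auto
  next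
    case False
    \<comment> \<open>Now \<open>f t > t\<close>, which excludes \<open>r = t\<close>; reflection
      turns the possible equality \<open>l = t\<close> into \<open>r' = t'\<close>.\<close>
    then show ?thesis
      using that[OF jump_map_reflect[OF f] _ topologically_conjugate_reflect] le ft
      by (auto simp: reflect_def)
  qed
qed

lemma jump_map_self_map:
  assumes "jump_map a b t l r f"
  shows "f ` {a..b} \<subseteq> {a..b}"
  using assms strict_mono_on_leD[of "{a..b}" f a] strict_mono_on_leD[of "{a..b}" f _ b]
  by (fastforce simp: jump_map_def)

text \<open>Both maps are normalized, the normal forms are conjugated, and the possible reflections
  are composed with the result.\<close>

lemma jump_map_conjugate:
  assumes f: "jump_map a b t l r f" and g: "jump_map c d s l' r' g"
    and "l < f t \<and> f t < r \<longleftrightarrow> l' < g s \<and> g s < r'"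
    and "l = t \<or> r = t \<longleftrightarrow> l' = s \<or> r' = s"
  shows "topologically_conjugate {a..b} f {c..d} g"
proof -
  obtain a1 b1 t1 l1 r1 f1 where f1: "jump_map a1 b1 t1 l1 r1 f1" "f1 t1 < t1"
    "topologically_conjugate {a..b} f {a1..b1} f1"
    "f1 t1 = l1 \<longleftrightarrow> \<not> (l < f t \<and> f t < r)" "r1 = t1 \<longleftrightarrow> l = t \<or> r = t"
    using jump_map_normalize[OF f] by blast
  obtain c1 d1 s1 l2 r2 g1 where g1: "jump_map c1 d1 s1 l2 r2 g1" "g1 s1 < s1"
    "topologically_conjugate {c..d} g {c1..d1} g1"
    "g1 s1 = l2 \<longleftrightarrow> \<not> (l' < g s \<and> g s < r')" "r2 = s1 \<longleftrightarrow> l' = s \<or> r' = s"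
    using jump_map_normalize[OF g] by blast
  have "topologically_conjugate {a1..b1} f1 {c1..d1} g1"
    using jump_map_conjugate_below[OF f1(1,2) g1(1,2)] f1(4,5) g1(4,5) assms(3,4) by simp
  then show ?thesis
    using f1(3) topologically_conjugate_sym[OF g1(3) jump_map_self_map[OF g]]
      topologically_conjugate_trans by blast
qed

section \<open>Isolated values as an invariant of conjugacy\<close>

text \<open>The homeomorphism carries sequences in the image of \<open>f\<close> to sequences in the
  image of \<open>g\<close>; continuity keeps the limit and injectivity keeps the terms away from
  it.\<close>

lemma topologically_conjugate_islimpt_image:
  fixes f :: "'a::first_countable_topology \<Rightarrow> 'a" and g :: "'b::first_countable_topology \<Rightarrow> 'b"
  assumes "topologically_conjugate S f T g" "f ` S \<subseteq> S"
    and lim: "\<forall>x\<in>S. f x islimpt f ` S"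
  shows "\<forall>y\<in>T. g y islimpt g ` T"
proof
  fix y assume "y \<in> T"
  obtain \<phi> \<psi> where h: "homeomorphism S T \<phi> \<psi>" and c: "\<forall>x\<in>S. \<phi> (f x) = g (\<phi> x)"
    using assms by (auto simp: topologically_conjugate_def)
  have im: "\<phi> ` S = T" and cont: "continuous_on S \<phi>" and inj: "inj_on \<phi> S"
    using h by (auto simp: homeomorphism_def intro: inj_on_inverseI)
  obtain x where x: "x \<in> S" "y = \<phi> x" using \<open>y \<in> T\<close> im by blast
  then obtain u where u: "\<And>n::nat. u n \<in> f ` S - {f x}" "u \<longlonglongrightarrow> f x"
    using lim unfolding islimpt_sequential by blast
  have S: "u n \<in> S" "f x \<in> S" for n using u(1) x assms(2) by blast+
  have "(\<lambda>n. \<phi> (u n)) \<longlonglongrightarrow> \<phi> (f x)"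
    using continuous_on_tendsto_compose[OF cont u(2)] S by simp
  moreover have "\<phi> (u n) \<in> g ` T - {\<phi> (f x)}" for n
  proof -
    obtain w where "w \<in> S" "u n = f w" using u(1) by blast
    then have "\<phi> (u n) = g (\<phi> w)" "\<phi> w \<in> T" using c im by auto
    moreover have "\<phi> (u n) \<noteq> \<phi> (f x)" using u(1)[of n] S inj by (auto simp: inj_on_eq_iff)
    ultimately show ?thesis by auto
  qed
  ultimately have "\<phi> (f x) islimpt g ` T"
    unfolding islimpt_sequential by (intro exI[of _ "\<lambda>n. \<phi> (u n)"]) blast
  then show "g y islimpt g ` T" using c x by simp
qed

text \<open>The image consists of two nondegenerate half-open intervals and the point
  \<open>f t\<close>. Only \<open>f t\<close> can be isolated, and it is so exactly when it lies
  strictly inside the gap.\<close>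

lemma jump_map_image_perfect:
  assumes f: "jump_map a b t l r f"
  shows "(\<forall>x\<in>{a..b}. f x islimpt f ` {a..b}) \<longleftrightarrow> \<not> (l < f t \<and> f t < r)"
proof -
  have ab: "a < t" "t < b" "f a = a" "f b = b"
    and im: "f ` {a..<t} = {a..<l}" "f ` {t<..b} = {r<..b}" and ft: "l \<le> f t" "f t \<le> r"
    using f by (auto simp: jump_map_def)
  have "a \<in> f ` {a..<t}" "b \<in> f ` {t<..b}" using ab by force+
  then have "a < l" "r < b" using im by auto
  have "{a..b} = {a..<t} \<union> {t} \<union> {t<..b}" using ab by auto
  then have image: "f ` {a..b} = {a..<l} \<union> {f t} \<union> {r<..b}"
    using im by (simp only: image_Un image_insert image_empty)
  have "f x islimpt f ` {a..b}" if x: "x \<in> {a..b}" and "\<not> (l < f t \<and> f t < r)" for x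
  proof -
    have "f x \<in> {a..<l} \<or> f x \<in> {r<..b} \<or> f x = l \<or> f x = r"
      using image x that(2) ft by (metis UnE imageI order_le_less singletonD)
    then have "f x islimpt {a..<l} \<or> f x islimpt {r<..b}"
    proof (elim disjE)
      assume "f x \<in> {a..<l}"
      \<comment> \<open>A connected set that is not a singleton has all its points as limit
        points.\<close>
      moreover have "{a..<l} \<noteq> {z}" for z
        using \<open>a < l\<close> dense[OF \<open>a < l\<close>]
        by (metis atLeastLessThan_iff less_irrefl less_le order_refl singletonD)
      ultimately show ?thesis using connected_imp_perfect[of "{a..<l}"] by simp
    next
      assume "f x \<in> {r<..b}"
      moreover have "{r<..b} \<noteq> {z}" for z
        using \<open>r < b\<close> dense[OF \<open>r < b\<close>]
        by (metis greaterThanAtMost_iff less_irrefl less_le order_refl singletonD)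
      ultimately show ?thesis using connected_imp_perfect[of "{r<..b}"] by simp
    next
      assume "f x = l"
      then have "f x islimpt {a<..<l}" using islimpt_greaterThanLessThan2[OF \<open>a < l\<close>] by simp
      then have "f x islimpt {a..<l}" by (rule islimpt_subset) auto
      then show ?thesis ..
    next
      assume "f x = r"
      then have "f x islimpt {r<..<b}" using islimpt_greaterThanLessThan1[OF \<open>r < b\<close>] by simp
      then have "f x islimpt {r<..b}" by (rule islimpt_subset) auto
      then show ?thesis ..
    qed
    then show ?thesis using image islimpt_subset by blast
  qed
  moreover have "\<not> f t islimpt f ` {a..b}" if "l < f t" "f t < r"
  proof
    assume "f t islimpt f ` {a..b}"
    moreover have "open {l<..<r}" "f t \<in> {l<..<r}" using that by auto
    ultimately obtain y where "y \<in> f ` {a..b}" "y \<in> {l<..<r}" "y \<noteq> f t"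
      by (meson islimptE)
    then show False using image by auto
  qed
  ultimately show ?thesis using ab by auto
qed

lemma jump_map_topologically_conjugate_iff:
  assumes f: "jump_map a b t l r f" and g: "jump_map c d s l' r' g"
    and "l = t \<or> r = t \<longleftrightarrow> l' = s \<or> r' = s"
  shows "topologically_conjugate {a..b} f {c..d} g \<longleftrightarrow>
    (l < f t \<and> f t < r \<longleftrightarrow> l' < g s \<and> g s < r')"
proof
  assume conj: "topologically_conjugate {a..b} f {c..d} g"
  have "(\<forall>x\<in>{a..b}. f x islimpt f ` {a..b}) \<longleftrightarrow> (\<forall>x\<in>{c..d}. g x islimpt g ` {c..d})"
    using topologically_conjugate_islimpt_image[OF conj jump_map_self_map[OF f]]
      topologically_conjugate_islimpt_image[OF
        topologically_conjugate_sym[OF conj jump_map_self_map[OF f]] jump_map_self_map[OF g]]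
    by blast
  then show "l < f t \<and> f t < r \<longleftrightarrow> l' < g s \<and> g s < r'"
    using jump_map_image_perfect[OF f] jump_map_image_perfect[OF g] by blast
qed (use jump_map_conjugate[OF f g] assms(3) in blast)

section \<open>From the topological conditions of the family to maps with a jump\<close>

text \<open>The limit is not attained, because a point \<open>z\<close> between \<open>x\<close> and
  \<open>t\<close> gives \<open>f x < f z \<le> l\<close>. A value below \<open>l\<close> is
  exceeded at some \<open>w < t\<close>, so the intermediate value theorem applies on
  \<open>{a..w}\<close>.\<close>

lemma left_limit_image:
  fixes f :: "real \<Rightarrow> real"
  assumes "a < t" and mono: "strict_mono_on {a..<t} f" and cont: "continuous_on {a..<t} f"
    and lim: "(f \<longlongrightarrow> l) (at_left t)"
  shows "f ` {a..<t} = {f a..<l}"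
proof
  show "f ` {a..<t} \<subseteq> {f a..<l}"
  proof
    fix y assume "y \<in> f ` {a..<t}"
    then obtain x where x: "x \<in> {a..<t}" "y = f x" by blast
    then obtain z where z: "x < z" "z < t" using dense[of x t] by auto
    have "\<forall>\<^sub>F w in at_left t. f z \<le> f w"
      unfolding eventually_at_left_field
      using z x strict_mono_on_leD[OF mono, of z] by (intro exI[of _ z]) auto
    then have "f z \<le> l" using tendsto_lowerbound[OF lim] by simp
    moreover have "f x < f z" "f a \<le> f x"
      using strict_mono_onD[OF mono, of x z] strict_mono_on_leD[OF mono, of a x] x z by auto
    ultimately show "y \<in> {f a..<l}" using x by simp
  qed
  show "{f a..<l} \<subseteq> f ` {a..<t}"
  proof
    fix y assume y: "y \<in> {f a..<l}"
    have "\<forall>\<^sub>F w in at_left t. y < f w" using order_tendstoD(1)[OF lim] y by simp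
    then have "\<forall>\<^sub>F w in at_left t. y < f w \<and> a < w \<and> w < t"
      using eventually_at_left_real[OF \<open>a < t\<close>] by eventually_elim auto
    then obtain w where w: "y < f w" "a < w" "w < t"
      using eventually_happens trivial_limit_at_left_real by (metis (no_types, lifting))
    have "continuous_on {a..w} f" using cont w by (auto intro: continuous_on_subset)
    then obtain x where "a \<le> x" "x \<le> w" "f x = y"
      using IVT'[of f a y w] y w by auto
    then show "y \<in> f ` {a..<t}" using w by auto
  qed
qed

lemma attractive_fixed_point_real:
  fixes f :: "real \<Rightarrow> real"
  assumes "attractive_fixed_point f S p"
  obtains e where "e > 0" "\<And>x. x \<in> S \<Longrightarrow> \<bar>x - p\<bar> < e \<Longrightarrow> (\<lambda>n. (f ^^ n) x) \<longlonglongrightarrow> p"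
proof -
  obtain U where U: "openin (top_of_set S) U" "p \<in> U" "\<forall>x\<in>U. (\<lambda>n. (f ^^ n) x) \<longlonglongrightarrow> p"
    using assms by (auto simp: attractive_fixed_point_def)
  then obtain e where "e > 0" "\<forall>x\<in>S. dist x p < e \<longrightarrow> x \<in> U"
    unfolding openin_euclidean_subtopology_iff by blast
  then show ?thesis using that U(3) by (auto simp: dist_real_def)
qed

text \<open>If \<open>f x > x\<close>, the absence of fixed points forces \<open>y \<le> f y\<close>
  for points \<open>y\<close> closer to \<open>a\<close>. By monotonicity the orbit of such a point
  stays at or above it and cannot converge to \<open>a\<close>.\<close>

lemma attracted_left_below_diagonal:
  fixes f :: "real \<Rightarrow> real"
  assumes mono: "strict_mono_on {a..b} f" and im: "f ` {a..b} \<subseteq> {a..b}"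
    and cont: "continuous_on {a..<t} f" and "t \<le> b"
    and nofix: "\<And>x. x \<in> {a<..<t} \<Longrightarrow> f x \<noteq> x"
    and e: "e > 0" "\<And>x. x \<in> {a..b} \<Longrightarrow> \<bar>x - a\<bar> < e \<Longrightarrow> (\<lambda>n. (f ^^ n) x) \<longlonglongrightarrow> a"
    and x: "x \<in> {a<..<t}"
  shows "f x < x"
proof (rule ccontr)
  assume "\<not> f x < x"
  then have fx: "x < f x" using nofix[OF x] by simp
  \<comment> \<open>This point is at most \<open>x\<close>, so that the two can be compared on
    \<open>{y..x}\<close>, and is within the radius of attraction of \<open>a\<close>.\<close>
  define y where "y = min x (a + e / 2)"
  have y: "a < y" "y \<le> x" "y < t" "\<bar>y - a\<bar> < e" "y \<in> {a..b}"
    using x e(1) \<open>t \<le> b\<close> by (auto simp: y_def)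
  have "y \<le> f y"
  proof (rule ccontr)
    assume "\<not> y \<le> f y"
    moreover have "continuous_on {y..x} (\<lambda>z. f z - z)"
      using cont x y by (intro continuous_intros) (auto intro: continuous_on_subset)
    ultimately obtain z where "y \<le> z" "z \<le> x" "f z - z = 0"
      using IVT'[of "\<lambda>z. f z - z" y 0 x] fx y by auto
    then show False using nofix[of z] x y by auto
  qed
  \<comment> \<open>The orbit may cross \<open>t\<close>; the induction therefore uses monotonicity
    on the whole interval and no continuity.\<close>
  have "(f ^^ n) y \<in> {a..b} \<and> y \<le> (f ^^ n) y" for n
  proof (induction n)
    case (Suc n)
    then have "f y \<le> f ((f ^^ n) y)" using strict_mono_on_leD[OF mono y(5)] by blast
    moreover have "f ((f ^^ n) y) \<in> {a..b}" using Suc im by blast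
    ultimately show ?case using \<open>y \<le> f y\<close> by simp
  qed (use y in simp)
  then have "y \<le> a" using LIMSEQ_le_const[OF e(2)[OF y(5,4)]] by blast
  then show False using y by simp
qed

lemma funpow_reflect: "(reflect f ^^ n) x = - (f ^^ n) (- x)"
  by (induction n) (auto simp: reflect_def)

text \<open>The two facts about the left side are applied to \<open>f\<close> and to
  \<open>reflect f\<close>; reflecting back gives the right side.\<close>

lemma jump_family_jump_map:
  assumes t: "t \<in> {a<..<b}" and f: "f \<in> jump_family a b t"
  shows "jump_map a b t (left_lim f t) (right_lim f t) f"
proof -
  have im: "f ` {a..b} \<subseteq> {a..b}" and mono: "strict_mono_on {a..b} f"
    and cont: "\<forall>x\<in>{a..b} - {t}. continuous (at x within {a..b}) f"
    and jump: "jump_discontinuity f t"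
    and ft: "left_lim f t \<le> f t" "f t \<le> right_lim f t"
    and fixed: "{x\<in>{a..b}. f x = x} = {a, b}"
    and attr: "attractive_fixed_point f {a..b} a" "attractive_fixed_point f {a..b} b"
    using f by (auto simp: jump_family_def)
  have ab: "a < t" "t < b" "f a = a" "f b = b" using t fixed by auto
  have nofix: "f x \<noteq> x" if "x \<in> {a<..<b}" for x
    using fixed that by (auto simp: set_eq_iff)
  obtain l r where "(f \<longlongrightarrow> l) (at_left t)" "(f \<longlongrightarrow> r) (at_right t)"
    using jump by (auto simp: jump_discontinuity_def)
  then have lim: "(f \<longlongrightarrow> left_lim f t) (at_left t)" "(f \<longlongrightarrow> right_lim f t) (at_right t)"
    unfolding left_lim_def right_lim_def by (simp_all add: tendsto_Lim)
  have cont_on: "continuous_on A f" if "A \<subseteq> {a..b} - {t}" for A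
    unfolding continuous_on_eq_continuous_within using that cont continuous_within_subset by blast
  have cont_left: "continuous_on {a..<t} f" using ab by (intro cont_on) auto
  let ?f = "reflect f"
  have mono': "strict_mono_on {- b..- a} ?f" using strict_mono_on_reflect[OF mono] .
  have im': "?f ` {- b..- a} \<subseteq> {- b..- a}"
    using im by (auto simp: reflect_def image_subset_iff)
  have cont': "continuous_on {- b..<- t} ?f"
    unfolding reflect_def
    by (intro continuous_on_minus continuous_on_compose2[OF cont_on[of "{t<..b}"]] continuous_intros)
      (use ab in auto)
  have "f ` {a..<t} = {f a..<left_lim f t}"
    using ab mono lim(1) cont_left
    by (intro left_limit_image) (auto intro: monotone_on_subset)
  moreover have "(?f \<longlongrightarrow> - right_lim f t) (at_left (- t))"
    unfolding filterlim_at_left_to_right reflect_def using tendsto_minus[OF lim(2)] by simp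
  then have "?f ` {- b..<- t} = {?f (- b)..<- right_lim f t}"
    using ab mono' cont' by (intro left_limit_image) (auto intro: monotone_on_subset)
  \<comment> \<open>Negating both sides undoes the reflection of the values.\<close>
  then have "uminus ` ?f ` {- b..<- t} = uminus ` {?f (- b)..<- right_lim f t}" by (rule arg_cong)
  then have "f ` {t<..b} = {right_lim f t<..b}"
    by (simp add: reflect_image image_image ab(4)) (simp add: reflect_def ab(4))
  moreover have "f x < x" if "x \<in> {a<..<t}" for x
  proof -
    obtain e where e: "e > 0" "\<And>x. x \<in> {a..b} \<Longrightarrow> \<bar>x - a\<bar> < e \<Longrightarrow> (\<lambda>n. (f ^^ n) x) \<longlonglongrightarrow> a"
      using attractive_fixed_point_real[OF attr(1)] by blast
    show ?thesis
      using attracted_left_below_diagonal[OF mono im cont_left _ _ e that] ab nofix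
      by simp
  qed
  moreover have "x < f x" if x: "x \<in> {t<..<b}" for x
  proof -
    obtain e where e: "e > 0" "\<And>x. x \<in> {a..b} \<Longrightarrow> \<bar>x - b\<bar> < e \<Longrightarrow> (\<lambda>n. (f ^^ n) x) \<longlonglongrightarrow> b"
      using attractive_fixed_point_real[OF attr(2)] by blast
    have e': "(\<lambda>n. (?f ^^ n) x) \<longlonglongrightarrow> - b" if "x \<in> {- b..- a}" "\<bar>x - - b\<bar> < e" for x
      unfolding funpow_reflect
      using that by (intro tendsto_minus e(2)) (auto simp: abs_if split: if_splits)
    have "?f (- x) < - x"
    proof (rule attracted_left_below_diagonal[OF mono' im' cont' _ _ e(1) e'])
      show "?f y \<noteq> y" if "y \<in> {- b<..<- t}" for y
        using nofix[of "- y"] that ab by (auto simp: reflect_def)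
    qed (use x ab in auto)
    then show ?thesis by (simp add: reflect_def)
  qed
  ultimately show ?thesis
    using ab mono ft nofix[of t] by (simp add: jump_map_def)
qed

theorem theorem3p1:
  fixes a b c d t s :: real and f g :: "real \<Rightarrow> real"
  assumes "t \<in> {a<..<b}" and "s \<in> {c<..<d}"
    and "f \<in> jump_family a b t" and "g \<in> jump_family c d s"
    and "limit_fixes f t \<longleftrightarrow> limit_fixes g s"
  shows "topologically_conjugate {a..b} f {c..d} g \<longleftrightarrow>
    (left_lim f t < f t \<and> f t < right_lim f t \<and>
     left_lim g s < g s \<and> g s < right_lim g s)
    \<or>
    (f t = left_lim f t \<and> g s = left_lim g s \<or>
     f t = left_lim f t \<and> g s = right_lim g s \<or>
     f t = right_lim f t \<and> g s = left_lim g s \<or>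
     f t = right_lim f t \<and> g s = right_lim g s)"
proof -
  have f: "jump_map a b t (left_lim f t) (right_lim f t) f"
    and g: "jump_map c d s (left_lim g s) (right_lim g s) g"
    using assms jump_family_jump_map by auto
  \<comment> \<open>Because \<open>f t\<close> lies weakly between its one-sided limits, the four
    alternatives of (C2) together say that strictness fails for both maps. So (C1) or (C2) means
    that strictness holds for both or for neither.\<close>
  have eq: "f t = left_lim f t \<longleftrightarrow> \<not> left_lim f t < f t" "f t = right_lim f t \<longleftrightarrow> \<not> f t < right_lim f t"
    "g s = left_lim g s \<longleftrightarrow> \<not> left_lim g s < g s" "g s = right_lim g s \<longleftrightarrow> \<not> g s < right_lim g s"
    using f g unfolding jump_map_def by linarith+
  show ?thesis
    unfolding eq jump_map_topologically_conjugate_iff[OF f g assms(5)[unfolded limit_fixes_def]]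
    by argo
qed

end
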